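(* There is no primitive axial algebra $(A,X)$ of Monster type over a field of characteristic $0$ with a set $X=\{a,b,c,d,e,f\}$ of six distinct axes such that the Miyamoto involutions act on $X$ as the permutations $\tau_x=(c,d)(e,f)$ for $x\in\{a,b\}$ and $\tau_x=(a,b)$ for $x\in\{c,d,e,f\}$ (so that the Miyamoto group is $2^2$), and such that 1. $\langle\!\langle a,c\rangle\!\rangle\cong\langle\!\langle a,e\rangle\!\rangle\cong 4\mathrm{B}$, and 2. $\langle\!\langle c,e\rangle\!\rangle\cong\langle\!\langle c,f\rangle\!\rangle\cong 2\mathrm{B}$. (That is, the corresponding shape collapses.)
   Context: Let $\mathbb{F}$ be a field of characteristic $0$. A (primitive) axial algebra of Monster type is a pair $(A,X)$, where $A$ is a commutative, not necessarily associative $\mathbb{F}$-algebra generated by a set $X$ of non-zero idempotents (axes) such that for every $a\in X$: the map $\mathrm{ad}_a\colon v\mapsto av$ is semisimple with all eigenvalues in $\{1,0,\frac14,\frac1{32}\}$; $A_1(a)=\langle a\rangle$ is $1$-dimensional (primitivity), where $A_\lambda(a)$ is the $\lambda$-eigenspace of $\mathrm{ad}_a$; and $A_\lambda(a)A_\mu(a)\subseteq\bigoplus_{\nu\in\lambda\star\mu}A_\nu(a)$, where $\star$ is the symmetric Monster fusion law $1\star1=\{1\}$, $1\star0=\emptyset$, $0\star0=\{0\}$, $1\star\frac14=0\star\frac14=\{\frac14\}$, $1\star\frac1{32}=0\star\frac1{32}=\frac14\star\frac1{32}=\{\frac1{32}\}$, $\frac14\star\frac14=\{1,0\}$, $\frac1{32}\star\frac1{32}=\{1,0,\frac14\}$.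 The Miyamoto involution $\tau_a$ is the automorphism of $A$ that is the identity on $A_1(a)\oplus A_0(a)\oplus A_{1/4}(a)$ and $-1$ on $A_{1/32}(a)$ (possibly trivial). The Miyamoto group is generated by all $\tau_a$, $a\in X$. $\langle\!\langle Y\rangle\!\rangle$ denotes the subalgebra generated by $Y$. The algebra $2\mathrm{B}$ has basis of idempotents $a_0,a_1$ with $a_0a_1=0$. The algebra $4\mathrm{B}$ has basis $a_{-1},a_0,a_1,a_2,a_{\rho^2}$ of idempotents (indices of $a_i$ modulo $4$), with $a_ia_{i+1}=\frac1{2^6}(a_i+a_{i+1}-a_{i-1}-a_{i+2}+a_{\rho^2})$, $a_ia_{i+2}=\frac18(a_i+a_{i+2}-a_{\rho^2})$, $a_ia_{\rho^2}=\frac18(a_i+a_{\rho^2}-a_{i+2})$. Writing $\langle\!\langle p,q\rangle\!\rangle\cong n\mathrm{L}$ means there is an algebra isomorphism taking the generating axes $p,q$ to $a_0,a_1$; the other axes $a_i$ are the images of $p,q$ under $\langle\tau_p,\tau_q\rangle$ with $a_{\epsilon+2k}=a_\epsilon^{\rho^k}$, $\epsilon\in\{0,1\}$, $\rho=\tau_p\tau_q$. *)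

theory Defs
  imports
    Complex_Main
    "HOL-Library.Numeral_Type"
    "HOL-Library.Function_Algebras"
    "HOL-Combinatorics.Transposition"
begin

text \<open>Algebra isomorphisms between carriers \<open>S\<close> and \<open>T\<close>, each with its own scalar
  multiplication and product.\<close>

definition algebra_iso ::
  "('f \<Rightarrow> 'u \<Rightarrow> 'u) \<Rightarrow> ('u \<Rightarrow> 'u \<Rightarrow> 'u) \<Rightarrow> 'u set \<Rightarrow>
   ('f \<Rightarrow> 'v \<Rightarrow> 'v) \<Rightarrow> ('v \<Rightarrow> 'v \<Rightarrow> 'v) \<Rightarrow> 'v set \<Rightarrow> ('u::plus \<Rightarrow> 'v::plus) \<Rightarrow> bool"
where
  "algebra_iso s1 m1 S s2 m2 T \<phi> \<longleftrightarrow>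
     bij_betw \<phi> S T \<and>
     (\<forall>x\<in>S. \<forall>y\<in>S. \<phi> (x + y) = \<phi> x + \<phi> y) \<and>
     (\<forall>k. \<forall>x\<in>S. \<phi> (s1 k x) = s2 k (\<phi> x)) \<and>
     (\<forall>x\<in>S. \<forall>y\<in>S. \<phi> (m1 x y) = m2 (\<phi> x) (\<phi> y))"

definition monster_spectrum :: "'f::field set" where
  "monster_spectrum = {1, 0, 1/4, 1/32}"

text \<open>The fusion law is symmetric, so an entry is looked up by the set of its two arguments;
  a singleton is a diagonal entry.\<close>

definition monster_fusion :: "'f::field \<Rightarrow> 'f \<Rightarrow> 'f set" where
  "monster_fusion l m =
     (if {l, m} = {1} then {1}
      else if {l, m} = {1, 0} then {}
      else if {l, m} = {0} then {0}
      else if {l, m} \<in> {{1, 1/4}, {0, 1/4}} then {1/4}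
      else if {l, m} \<in> {{1, 1/32}, {0, 1/32}, {1/4, 1/32}} then {1/32}
      else if {l, m} = {1/4} then {1, 0}
      else if {l, m} = {1/32} then {1, 0, 1/4}
      else {})"

locale commutative_algebra = vector_space scale
  for scale :: "'f::field \<Rightarrow> 'v::ab_group_add \<Rightarrow> 'v" (infixr \<open>*s\<close> 75) +
  fixes mult :: "'v \<Rightarrow> 'v \<Rightarrow> 'v" (infixl \<open>\<cdot>\<close> 70)
  assumes mult_commute: "x \<cdot> y = y \<cdot> x"
    and mult_add_left: "(x + y) \<cdot> z = x \<cdot> z + y \<cdot> z"
    and mult_scale_left: "(k *s x) \<cdot> y = k *s (x \<cdot> y)"
begin

definition subalgebra :: "'v set \<Rightarrow> bool" where
  "subalgebra S \<longleftrightarrow> subspace S \<and> (\<forall>x\<in>S. \<forall>y\<in>S. x \<cdot> y \<in> S)"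

definition generated :: "'v set \<Rightarrow> 'v set" where
  "generated Y = subalgebra hull Y"

definition eigenspace :: "'v \<Rightarrow> 'f \<Rightarrow> 'v set" where
  "eigenspace a l = {v. a \<cdot> v = l *s v}"

text \<open>Eigenspaces for distinct eigenvalues are independent, so the sum of the eigenspaces
  indexed by \<open>L\<close> is direct.\<close>

definition eigensum :: "'v \<Rightarrow> 'f set \<Rightarrow> 'v set" where
  "eigensum a L = span (\<Union>l\<in>L. eigenspace a l)"

definition semisimple_ad :: "'v \<Rightarrow> bool" where
  "semisimple_ad a \<longleftrightarrow> eigensum a UNIV = UNIV"

definition eigenvalues :: "'v \<Rightarrow> 'f set" where
  "eigenvalues a = {l. \<exists>v. v \<noteq> 0 \<and> a \<cdot> v = l *s v}"

definition monster_axis :: "'v \<Rightarrow> bool" where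
  "monster_axis a \<longleftrightarrow>
     a \<noteq> 0 \<and> a \<cdot> a = a \<and>
     semisimple_ad a \<and> eigenvalues a \<subseteq> monster_spectrum \<and>
     eigenspace a 1 = span {a} \<and>
     (\<forall>l\<in>monster_spectrum. \<forall>m\<in>monster_spectrum.
        \<forall>x\<in>eigenspace a l. \<forall>y\<in>eigenspace a m. x \<cdot> y \<in> eigensum a (monster_fusion l m))"

text \<open>For a Monster axis in characteristic 0 such an automorphism exists, by the fusion law, and
  is unique, because the eigenvectors span the algebra.\<close>

definition miyamoto :: "'v \<Rightarrow> 'v \<Rightarrow> 'v" where
  "miyamoto a = (THE t. algebra_iso scale mult UNIV scale mult UNIV t \<and>
     (\<forall>v \<in> eigensum a {1, 0, 1/4}. t v = v) \<and>
     (\<forall>v \<in> eigenspace a (1/32). t v = - v))"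

end

locale monster_axial_algebra = commutative_algebra scale mult
  for scale :: "'f::field_char_0 \<Rightarrow> 'v::ab_group_add \<Rightarrow> 'v" and mult :: "'v \<Rightarrow> 'v \<Rightarrow> 'v" +
  fixes X :: "'v set"
  assumes generated_axes: "generated X = UNIV"
    and axes: "x \<in> X \<Longrightarrow> monster_axis x"

text \<open>Finite-dimensional algebras are given on coordinate functions \<open>'i \<Rightarrow> 'f\<close> over a finite
  basis \<open>'i\<close> by a table of products of basis vectors. Function addition is pointwise; the
  pointwise product of functions is not the algebra product.\<close>

definition fun_scale :: "'f::field \<Rightarrow> ('i \<Rightarrow> 'f) \<Rightarrow> 'i \<Rightarrow> 'f" where
  "fun_scale k v = (\<lambda>i. k * v i)"

definition basis_vec :: "'i \<Rightarrow> 'i \<Rightarrow> 'f::field" where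
  "basis_vec i = (\<lambda>j. if j = i then 1 else 0)"

definition table_mult :: "('i::finite \<Rightarrow> 'i \<Rightarrow> 'i \<Rightarrow> 'f::field) \<Rightarrow> ('i \<Rightarrow> 'f) \<Rightarrow> ('i \<Rightarrow> 'f) \<Rightarrow> 'i \<Rightarrow> 'f" where
  "table_mult t u v = (\<Sum>i\<in>UNIV. \<Sum>j\<in>UNIV. fun_scale (u i * v j) (t i j))"

definition table_2B :: "2 \<Rightarrow> 2 \<Rightarrow> 2 \<Rightarrow> 'f::field" where
  "table_2B i j = (if i = j then basis_vec i else 0)"

text \<open>The basis of 4B is indexed by \<open>4 option\<close>: \<open>Some i\<close> is the axis \<open>a\<^sub>i\<close>, the arithmetic of
  type \<open>4\<close> being modulo 4, and \<open>None\<close> is the remaining idempotent.\<close>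

definition axis_4B :: "4 \<Rightarrow> 4 option \<Rightarrow> 'f::field" where
  "axis_4B i = basis_vec (Some i)"

definition rho_4B :: "4 option \<Rightarrow> 'f::field" where
  "rho_4B = basis_vec None"

definition adjacent_4B :: "4 \<Rightarrow> 4 option \<Rightarrow> 'f::field" where
  "adjacent_4B i = fun_scale (1 / 2 ^ 6)
     (axis_4B i + axis_4B (i + 1) - axis_4B (i - 1) - axis_4B (i + 2) + rho_4B)"

fun table_4B :: "4 option \<Rightarrow> 4 option \<Rightarrow> 4 option \<Rightarrow> 'f::field" where
  "table_4B (Some i) (Some j) =
     (if j = i then axis_4B i
      else if j = i + 1 then adjacent_4B i
      else if i = j + 1 then adjacent_4B j
      else fun_scale (1 / 8) (axis_4B i + axis_4B (i + 2) - rho_4B))"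
| "table_4B (Some i) None = fun_scale (1 / 8) (axis_4B i + rho_4B - axis_4B (i + 2))"
| "table_4B None (Some i) = fun_scale (1 / 8) (axis_4B i + rho_4B - axis_4B (i + 2))"
| "table_4B None None = rho_4B"

text \<open>The labelling of the remaining axes of 4B by the action of the Miyamoto involutions of
  \<open>p\<close> and \<open>q\<close> is not a separate condition: an isomorphism sending \<open>p, q\<close> to \<open>a\<^sub>0, a\<^sub>1\<close>
  determines it.\<close>

context commutative_algebra
begin

definition dihedral_2B :: "'v \<Rightarrow> 'v \<Rightarrow> bool" where
  "dihedral_2B p q \<longleftrightarrow>
     (\<exists>\<phi>. algebra_iso scale mult (generated {p, q}) fun_scale (table_mult table_2B) UNIV \<phi> \<and>
          \<phi> p = basis_vec 0 \<and> \<phi> q = basis_vec 1)"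

definition dihedral_4B :: "'v \<Rightarrow> 'v \<Rightarrow> bool" where
  "dihedral_4B p q \<longleftrightarrow>
     (\<exists>\<phi>. algebra_iso scale mult (generated {p, q}) fun_scale (table_mult table_4B) UNIV \<phi> \<and>
          \<phi> p = axis_4B 0 \<and> \<phi> q = axis_4B 1)"

end

end

theory Submission
  imports Defs
begin

text \<open>
  Write \<open>u\<close> for the fifth basis vector \<open>a\<^bsub>\<rho>\<^sup>2\<^esub>\<close> of the algebra 4B generated by \<open>a\<close> and \<open>c\<close>.  The
  Miyamoto involutions force its third axis to be \<open>b\<close>, so \<open>u = a + b - 8 a b\<close>.  The same formula
  holds in the algebra 4B generated by \<open>a\<close> and \<open>e\<close>, hence both algebras share \<open>u\<close>; in the second
  one the fourth axis is \<open>f\<close>, so also \<open>u = e + f - 8 e f\<close>.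

  The two 2B conditions say that \<open>e\<close> and \<open>f\<close> lie in the \<open>0\<close>-eigenspace of \<open>c\<close>.  By the fusion law
  this eigenspace is closed under multiplication, so it contains \<open>e f\<close> and therefore \<open>u\<close>.  In the
  first 4B, however, \<open>c u = (c + u - s) / 8\<close> with \<open>s\<close> the fourth axis, so \<open>s = c + u\<close>.  Multiplying
  by \<open>c\<close> gives \<open>c s = c\<close>, whereas the 4B table gives \<open>c s = (c + s - u) / 8 = c / 4\<close>.  Hence
  \<open>c = 0\<close>, which no axis is.

  The formal work lies in the identification of \<open>b\<close> and \<open>f\<close> inside the 4B algebras.  It needs that
  the Miyamoto map, a definite description, really is the sign change on the \<open>1/32\<close>-eigenspace
  (\<open>miyamoto_add\<close>), and it needs \<open>a\<^sub>1\<close> split into its even and odd parts with respect to \<open>a\<^sub>0\<close> in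
  the algebra 4B (\<open>miyamoto_4B\<close>).
\<close>

section \<open>Products in the dihedral algebras 2B and 4B\<close>

text \<open>Reads off a product from the table of the target algebra: an isomorphism is injective, so an
  identity between images already holds in the source, provided both sides lie there.\<close>

lemma algebra_iso_product_eqI:
  assumes iso: "algebra_iso s1 m1 S s2 m2 T \<phi>"
    and "x \<in> S" "y \<in> S" "m1 x y \<in> S" "z \<in> S"
    and "m2 (\<phi> x) (\<phi> y) = \<phi> z"
  shows "m1 x y = z"
proof -
  have "\<phi> (m1 x y) = \<phi> z"
    using assms by (simp add: algebra_iso_def)
  moreover have "inj_on \<phi> S"
    using iso by (simp add: algebra_iso_def bij_betw_def)
  ultimately show ?thesis
    using assms by (simp add: inj_on_eq_iff)
qed

lemma table_mult_basis_vec: "table_mult t (basis_vec i) (basis_vec j) = t i j"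
proof -
  have "fun_scale (basis_vec i k * basis_vec j l) (t k l) =
      (if k = i then if l = j then t i j else 0 else 0)" for k l
    by (auto simp: fun_scale_def basis_vec_def fun_eq_iff)
  then show ?thesis
    by (simp add: table_mult_def sum.If_cases)
qed

context commutative_algebra
begin

lemma mult_add_right: "x \<cdot> (y + z) = x \<cdot> y + x \<cdot> z"
  by (metis mult_commute mult_add_left)

lemma mult_scale_right: "x \<cdot> (k *s y) = k *s (x \<cdot> y)"
  by (metis mult_commute mult_scale_left)

lemma mult_zero_right: "x \<cdot> 0 = 0"
  using mult_add_right[of x 0 0] by simp

lemma mult_diff_right: "x \<cdot> (y - z) = x \<cdot> y - x \<cdot> z"
  using mult_add_right[of x "y - z" z] by (simp add: algebra_simps)

lemma subspace_eigenspace: "subspace (eigenspace a l)"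
  by (auto simp: subspace_def eigenspace_def mult_zero_right mult_add_right mult_scale_right
      scale_right_distrib scale_left_commute)

lemma subspace_eigensum: "subspace (eigensum a L)"
  by (simp add: eigensum_def)

lemma eigenspace_subset_eigensum: "l \<in> L \<Longrightarrow> eigenspace a l \<subseteq> eigensum a L"
  by (auto simp: eigensum_def intro: span_base)

lemma eigensum_mono: "L \<subseteq> M \<Longrightarrow> eigensum a L \<subseteq> eigensum a M"
  unfolding eigensum_def by (intro span_mono) auto

lemma eigensum_singleton: "eigensum a {l} = eigenspace a l"
  by (simp add: eigensum_def subspace_eigenspace)

text \<open>By bilinearity it is enough to multiply eigenvectors.\<close>

lemma eigensum_productI:
  assumes U: "subspace U"
    and prod: "\<And>l m x y. l \<in> L \<Longrightarrow> m \<in> M \<Longrightarrow> x \<in> eigenspace a l \<Longrightarrow> y \<in> eigenspace a m \<Longrightarrow> x \<cdot> y \<in> U"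
    and x: "x \<in> eigensum a L" and y: "y \<in> eigensum a M"
  shows "x \<cdot> y \<in> U"
proof -
  have left: "subspace {x. x \<cdot> y \<in> U}" for y
    using U by (auto simp: subspace_def mult_add_left mult_scale_left mult_zero_right mult_commute[of 0])
  have right: "subspace {y. x \<cdot> y \<in> U}" for x
    using U by (auto simp: subspace_def mult_add_right mult_scale_right mult_zero_right)
  have "x' \<cdot> y \<in> U" if x': "x' \<in> (\<Union>l\<in>L. eigenspace a l)" for x'
    using span_induct[OF y[unfolded eigensum_def] right[of x']] x' prod by blast
  then show ?thesis
    using span_induct[OF x[unfolded eigensum_def] left[of y]] by blast
qed

lemma monster_axis_fusion:
  assumes "monster_axis a" "l \<in> monster_spectrum" "m \<in> monster_spectrum"
    and "x \<in> eigenspace a l" "y \<in> eigenspace a m" "monster_fusion l m \<subseteq> L"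
  shows "x \<cdot> y \<in> eigensum a L"
  using assms eigensum_mono unfolding monster_axis_def by blast

lemma subset_generated: "Y \<subseteq> generated Y"
  by (simp add: generated_def hull_subset)

lemma subalgebra_generated: "subalgebra (generated Y)"
  unfolding generated_def
  by (rule hull_in) (auto simp: subalgebra_def intro!: subspace_Inter)

lemma dihedral_2B_product_eq_0:
  assumes "dihedral_2B p q"
  shows "p \<cdot> q = 0"
proof -
  let ?S = "generated {p, q}"
  obtain \<phi> where iso: "algebra_iso scale mult ?S fun_scale (table_mult table_2B) UNIV \<phi>"
    and \<phi>: "\<phi> p = basis_vec 0" "\<phi> q = basis_vec 1"
    using assms unfolding dihedral_2B_def by blast
  have S: "p \<in> ?S" "q \<in> ?S" "p \<cdot> q \<in> ?S" "0 \<in> ?S"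
    using subset_generated[of "{p, q}"] subalgebra_generated[of "{p, q}"]
    by (auto simp: subalgebra_def subspace_0)
  have "\<phi> (0 *s p) = fun_scale 0 (\<phi> p)"
    using iso S(1) unfolding algebra_iso_def by blast
  then have "\<phi> 0 = 0"
    by (simp add: fun_scale_def fun_eq_iff)
  then show ?thesis
    using S by (intro algebra_iso_product_eqI[OF iso])
      (simp_all add: \<phi> table_mult_basis_vec table_2B_def zero_fun_def)
qed

text \<open>The products of the axis \<open>p = a\<^sub>0\<close> of 4B with \<open>q = a\<^sub>1\<close>, \<open>r = a\<^sub>2\<close>, \<open>s = a\<^sub>3\<close> and
  \<open>u = a\<^bsub>\<rho>\<^sup>2\<^esub>\<close>.  The table of 4B is symmetric under \<open>i \<mapsto> 1 - i\<close>, so the products with \<open>q\<close>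
  follow the same pattern after exchanging \<open>p\<close> with \<open>q\<close> and \<open>r\<close> with \<open>s\<close>.\<close>

definition axis_products_4B :: "'v \<Rightarrow> 'v \<Rightarrow> 'v \<Rightarrow> 'v \<Rightarrow> 'v \<Rightarrow> bool" where
  "axis_products_4B p q r s u \<longleftrightarrow>
     p \<cdot> q = (1 / 64) *s (p + q - s - r + u) \<and>
     p \<cdot> s = (1 / 64) *s (p + s - q - r + u) \<and>
     p \<cdot> r = (1 / 8) *s (p + r - u) \<and>
     p \<cdot> u = (1 / 8) *s (p + u - r)"

lemma dihedral_4B_axis_products:
  assumes "dihedral_4B p q"
  obtains r s u where "axis_products_4B p q r s u" and "axis_products_4B q p s r u"
proof -
  let ?S = "generated {p, q}"
  obtain \<phi> where iso: "algebra_iso scale mult ?S fun_scale (table_mult table_4B) UNIV \<phi>"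
    and \<phi>: "\<phi> p = axis_4B 0" "\<phi> q = axis_4B 1"
    using assms unfolding dihedral_4B_def by blast
  have pq: "p \<in> ?S" "q \<in> ?S"
    using subset_generated[of "{p, q}"] by auto
  have sub: "subspace ?S" and closed: "x \<in> ?S \<Longrightarrow> y \<in> ?S \<Longrightarrow> x \<cdot> y \<in> ?S" for x y
    using subalgebra_generated[of "{p, q}"] by (auto simp: subalgebra_def)
  have "\<phi> ` ?S = UNIV"
    using iso by (simp add: algebra_iso_def bij_betw_def)
  then have "\<exists>x\<in>?S. \<phi> x = y" for y
    by (metis UNIV_I imageE)
  then obtain r s u where rsu: "r \<in> ?S" "s \<in> ?S" "u \<in> ?S"
    and \<phi>': "\<phi> r = axis_4B 2" "\<phi> s = axis_4B 3" "\<phi> u = rho_4B"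
    by metis
  have add: "\<phi> (x + y) = \<phi> x + \<phi> y" if "x \<in> ?S" "y \<in> ?S" for x y
    using iso that by (simp add: algebra_iso_def)
  have scl: "\<phi> (k *s x) = fun_scale k (\<phi> x)" if "x \<in> ?S" for k x
    using iso that by (simp add: algebra_iso_def)
  have diff: "\<phi> (x - y) = \<phi> x - \<phi> y" if "x \<in> ?S" "y \<in> ?S" for x y
    using add[of "x - y" y] that sub by (simp add: subspace_diff)
  note S = pq rsu subspace_add[OF sub] subspace_diff[OF sub] subspace_scale[OF sub]
  have table: "x \<cdot> y = z"
    if "x \<in> ?S" "y \<in> ?S" "z \<in> ?S" "\<phi> x = basis_vec i" "\<phi> y = basis_vec j" "table_4B i j = \<phi> z"
    for x y z i j
    using that closed
    by (intro algebra_iso_product_eqI[OF iso]) (simp_all add: table_mult_basis_vec)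
  note axes = \<phi>[unfolded axis_4B_def] \<phi>'[unfolded axis_4B_def rho_4B_def]
  \<comment> \<open>indices are read modulo 4\<close>
  have mod4: "- 1 = (3::4)" "4 = (0::4)" "5 = (1::4)"
    by simp_all
  show ?thesis
  proof
    show "axis_products_4B p q r s u"
      unfolding axis_products_4B_def
      by (intro conjI; rule table[OF _ _ _ axes(1)], (rule S axes | assumption)+)
        (simp_all add: S add diff scl \<phi> \<phi>' mod4 adjacent_4B_def fun_scale_def fun_eq_iff algebra_simps
          add_divide_distrib diff_divide_distrib)
    show "axis_products_4B q p s r u"
      unfolding axis_products_4B_def
      by (intro conjI; rule table[OF _ _ _ axes(2)], (rule S axes | assumption)+)
        (simp_all add: S add diff scl \<phi> \<phi>' mod4 adjacent_4B_def fun_scale_def fun_eq_iff algebra_simps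
          add_divide_distrib diff_divide_distrib)
  qed
qed

end

section \<open>The Miyamoto involution as a sign change\<close>

text \<open>In characteristic \<open>0\<close> the four eigenvalues are distinct, so the entries of the fusion law do
  not overlap.\<close>

locale commutative_algebra_char_0 = commutative_algebra scale mult
  for scale :: "'f::field_char_0 \<Rightarrow> 'v::ab_group_add \<Rightarrow> 'v" (infixr \<open>*s\<close> 75)
    and mult :: "'v \<Rightarrow> 'v \<Rightarrow> 'v" (infixl \<open>\<cdot>\<close> 70)
begin

lemma monster_fusion_zero_zero: "monster_fusion 0 (0::'f) = {0}"
  unfolding monster_fusion_def doubleton_eq_iff by simp

text \<open>The fusion law is graded by the group of order two, the eigenvalue \<open>1/32\<close> being odd.\<close>

lemma monster_fusion_graded:
  fixes l m :: 'f
  shows "l \<in> {1, 0, 1/4} \<Longrightarrow> m \<in> {1, 0, 1/4} \<Longrightarrow> monster_fusion l m \<subseteq> {1, 0, 1/4}"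
    and "l \<in> {1, 0, 1/4} \<Longrightarrow> monster_fusion l (1/32) \<subseteq> {1/32}"
    and "monster_fusion (1/32) (1/32) \<subseteq> {1, 0, 1/4 :: 'f}"
  by ((elim insertE emptyE; hypsubst; simp add: monster_fusion_def doubleton_eq_iff)
      | simp add: monster_fusion_def doubleton_eq_iff)+

lemma zero_eigenspace_mult_closed:
  assumes "monster_axis a" "x \<in> eigenspace a 0" "y \<in> eigenspace a 0"
  shows "x \<cdot> y \<in> eigenspace a 0"
proof -
  have "(0::'f) \<in> monster_spectrum"
    by (simp add: monster_spectrum_def)
  then have "x \<cdot> y \<in> eigensum a {0}"
    using monster_axis_fusion[OF assms(1) _ _ assms(2,3)] by (simp add: monster_fusion_zero_zero)
  then show ?thesis
    by (simp add: eigensum_singleton)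
qed

definition even_part :: "'v \<Rightarrow> 'v set" where
  "even_part a = eigensum a {1, 0, 1/4}"

definition odd_part :: "'v \<Rightarrow> 'v set" where
  "odd_part a = eigensum a {1/32}"

lemma subspace_parts: "subspace (even_part a)" "subspace (odd_part a)"
  by (simp_all add: even_part_def odd_part_def subspace_eigensum)

lemma even_odd_decomposition:
  assumes a: "monster_axis a"
  obtains x y where "x \<in> even_part a" "y \<in> odd_part a" "v = x + y"
proof -
  let ?sums = "{x + y |x y. x \<in> even_part a \<and> y \<in> odd_part a}"
  have sub: "subspace ?sums"
    using subspace_sums[OF subspace_parts] .
  have "w \<in> ?sums" if w: "w \<in> eigenspace a l" for w l
  proof (cases "w = 0")
    case True
    then show ?thesis
      using subspace_0[OF sub] by simp
  next
    case False
    then have "l \<in> eigenvalues a"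
      using w by (auto simp: eigenvalues_def eigenspace_def)
    then have "l \<in> {1, 0, 1/4} \<or> l \<in> {1/32}"
      using a by (auto simp: monster_axis_def monster_spectrum_def)
    then have "w \<in> even_part a \<or> w \<in> odd_part a"
      unfolding even_part_def odd_part_def using w eigenspace_subset_eigensum by (meson subsetD)
    moreover have "w = w + 0" "w = 0 + w"
      by simp_all
    moreover have "0 \<in> even_part a" "0 \<in> odd_part a"
      by (simp_all add: subspace_0 subspace_parts)
    ultimately show ?thesis
      by blast
  qed
  then have "span (\<Union>l\<in>UNIV. eigenspace a l) \<subseteq> ?sums"
    by (intro span_minimal sub) auto
  moreover have "span (\<Union>l\<in>UNIV. eigenspace a l) = UNIV"
    using a by (simp add: monster_axis_def semisimple_ad_def eigensum_def)
  ultimately have "v \<in> ?sums"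
    by auto
  then show ?thesis
    using that by auto
qed

lemma even_odd_grading:
  assumes a: "monster_axis a"
  shows "x \<in> even_part a \<Longrightarrow> y \<in> even_part a \<Longrightarrow> x \<cdot> y \<in> even_part a"
    and "x \<in> even_part a \<Longrightarrow> y \<in> odd_part a \<Longrightarrow> x \<cdot> y \<in> odd_part a"
    and "x \<in> odd_part a \<Longrightarrow> y \<in> odd_part a \<Longrightarrow> x \<cdot> y \<in> even_part a"
proof -
  have spectrum: "monster_spectrum = {1, 0, 1/4} \<union> {1/32 :: 'f}"
    by (auto simp: monster_spectrum_def)
  have product: "x \<cdot> y \<in> eigensum a N"
    if xy: "x \<in> eigensum a L" "y \<in> eigensum a M"
      and LM: "L \<union> M \<subseteq> monster_spectrum"
      and fusion: "\<And>l m. l \<in> L \<Longrightarrow> m \<in> M \<Longrightarrow> monster_fusion l m \<subseteq> N"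
    for x y L M N
    using LM fusion by (intro eigensum_productI[OF subspace_eigensum _ xy] monster_axis_fusion[OF a]) auto
  show "x \<in> even_part a \<Longrightarrow> y \<in> even_part a \<Longrightarrow> x \<cdot> y \<in> even_part a"
    and "x \<in> even_part a \<Longrightarrow> y \<in> odd_part a \<Longrightarrow> x \<cdot> y \<in> odd_part a"
    and "x \<in> odd_part a \<Longrightarrow> y \<in> odd_part a \<Longrightarrow> x \<cdot> y \<in> even_part a"
    unfolding even_part_def odd_part_def
    by (erule product, assumption, simp add: spectrum, use monster_fusion_graded in blast)+
qed

text \<open>The polynomial \<open>t (t - 1) (t - 1/4)\<close> vanishes at the even eigenvalues and takes the value
  \<open>217/32768\<close> at \<open>1/32\<close>, so a multiple of it, evaluated at the multiplication by \<open>a\<close>, is the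
  projection to the odd part.  Subtracting it twice from the identity changes the sign there.\<close>

definition odd_sign_change :: "'v \<Rightarrow> 'v \<Rightarrow> 'v" where
  "odd_sign_change a v =
     v - (2 * 32768 / 217) *s (a \<cdot> (a \<cdot> (a \<cdot> v)) - (5/4) *s (a \<cdot> (a \<cdot> v)) + (1/4) *s (a \<cdot> v))"

lemma odd_sign_change_add: "odd_sign_change a (v + w) = odd_sign_change a v + odd_sign_change a w"
  by (simp add: odd_sign_change_def mult_add_right scale_right_distrib scale_right_diff_distrib)

lemma odd_sign_change_scale: "odd_sign_change a (k *s v) = k *s odd_sign_change a v"
  by (simp add: odd_sign_change_def mult_scale_right scale_right_distrib scale_right_diff_distrib
      scale_left_commute mult.commute)

lemma odd_sign_change_eigenspace:
  assumes "v \<in> eigenspace a l"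
  shows "odd_sign_change a v = (1 - (2 * 32768 / 217) * (l * (l - 1) * (l - 1/4))) *s v"
proof -
  have "a \<cdot> v = l *s v"
    using assms by (simp add: eigenspace_def)
  then have "odd_sign_change a v =
      v - (2 * 32768 / 217) *s ((l * l * l) *s v - (5/4 * (l * l)) *s v + (1/4 * l) *s v)"
    by (simp add: odd_sign_change_def mult_scale_right)
  also have "(l * l * l) *s v - (5/4 * (l * l)) *s v + (1/4 * l) *s v = (l * (l - 1) * (l - 1/4)) *s v"
    unfolding scale_left_diff_distrib[symmetric] scale_left_distrib[symmetric]
    by (simp add: field_simps)
  finally show ?thesis
    by (simp add: scale_left_diff_distrib)
qed

lemma odd_sign_change_even:
  assumes "x \<in> even_part a"
  shows "odd_sign_change a x = x"
proof -
  have "subspace {x. odd_sign_change a x = x}"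
    using odd_sign_change_scale[of a 0 0]
    by (auto simp: subspace_def odd_sign_change_add odd_sign_change_scale)
  moreover have "odd_sign_change a y = y" if "l \<in> {1, 0, 1/4}" "y \<in> eigenspace a l" for l y
    using that(1) unfolding odd_sign_change_eigenspace[OF that(2)]
    by (elim insertE emptyE; hypsubst; simp)
  ultimately have "eigensum a {1, 0, 1/4} \<subseteq> {x. odd_sign_change a x = x}"
    unfolding eigensum_def by (intro span_minimal) blast+
  then show ?thesis
    using assms by (auto simp: even_part_def)
qed

lemma odd_sign_change_odd:
  assumes "y \<in> odd_part a"
  shows "odd_sign_change a y = - y"
  using assms by (simp add: odd_part_def eigensum_singleton odd_sign_change_eigenspace)

lemma odd_sign_change_even_odd:
  "x \<in> even_part a \<Longrightarrow> y \<in> odd_part a \<Longrightarrow> odd_sign_change a (x + y) = x - y"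
  by (simp add: odd_sign_change_add odd_sign_change_even odd_sign_change_odd)

text \<open>The sign change respects products because the fusion law is graded.\<close>

lemma algebra_iso_odd_sign_change:
  assumes a: "monster_axis a"
  shows "algebra_iso scale mult UNIV scale mult UNIV (odd_sign_change a)"
proof -
  have "odd_sign_change a (odd_sign_change a v) = v" for v
  proof -
    obtain x y where v: "x \<in> even_part a" "y \<in> odd_part a" "v = x + y"
      using even_odd_decomposition[OF a] by blast
    then show ?thesis
      using odd_sign_change_even_odd[of x a "- y"] subspace_neg[OF subspace_parts(2)]
      by (simp add: odd_sign_change_even_odd)
  qed
  then have "bij (odd_sign_change a)"
    by (rule involuntory_imp_bij)
  moreover have "odd_sign_change a (v \<cdot> w) = odd_sign_change a v \<cdot> odd_sign_change a w" for v w
  proof -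
    obtain x y where v: "x \<in> even_part a" "y \<in> odd_part a" "v = x + y"
      using even_odd_decomposition[OF a] by blast
    obtain x' y' where w: "x' \<in> even_part a" "y' \<in> odd_part a" "w = x' + y'"
      using even_odd_decomposition[OF a] by blast
    let ?even = "x \<cdot> x' + y \<cdot> y'" and ?odd = "x \<cdot> y' + x' \<cdot> y"
    have "?even \<in> even_part a" "?odd \<in> odd_part a"
      using v w by (simp_all add: even_odd_grading[OF a] subspace_add[OF subspace_parts(1)]
          subspace_add[OF subspace_parts(2)])
    moreover have "v \<cdot> w = ?even + ?odd"
      by (simp add: v w mult_add_left mult_add_right mult_commute[of x' y] algebra_simps)
    moreover have "(x - y) \<cdot> (x' - y') = ?even - ?odd"
      by (simp add: mult_diff_right mult_commute[of "x - y"] mult_commute[of x' y]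
          mult_commute[of x' x] mult_commute[of y' x] mult_commute[of y' y] algebra_simps)
    ultimately show ?thesis
      using v w by (simp add: odd_sign_change_even_odd)
  qed
  ultimately show ?thesis
    by (simp add: algebra_iso_def odd_sign_change_add odd_sign_change_scale)
qed

text \<open>The sign change is an automorphism with the two properties that describe the Miyamoto map, and
  it is the only one because even and odd vectors span the algebra.\<close>

lemma miyamoto_add:
  assumes a: "monster_axis a" and xy: "x \<in> even_part a" "y \<in> odd_part a"
  shows "miyamoto a (x + y) = x - y"
proof -
  have "miyamoto a = odd_sign_change a"
    unfolding miyamoto_def
  proof (rule the_equality, intro conjI ballI)
    show "algebra_iso scale mult UNIV scale mult UNIV (odd_sign_change a)"
      by (rule algebra_iso_odd_sign_change[OF a])
    show "odd_sign_change a v = v" if "v \<in> eigensum a {1, 0, 1/4}" for v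
      using that by (simp add: odd_sign_change_even even_part_def)
    show "odd_sign_change a v = - v" if "v \<in> eigenspace a (1/32)" for v
      using that by (simp add: odd_sign_change_odd odd_part_def eigensum_singleton)
  next
    fix t
    assume t: "algebra_iso scale mult UNIV scale mult UNIV t \<and>
      (\<forall>v\<in>eigensum a {1, 0, 1/4}. t v = v) \<and> (\<forall>v\<in>eigenspace a (1/32). t v = - v)"
    show "t = odd_sign_change a"
    proof
      fix v
      obtain x y where v: "x \<in> even_part a" "y \<in> odd_part a" "v = x + y"
        using even_odd_decomposition[OF a] by blast
      have "t v = t x + t y"
        using t by (simp add: v(3) algebra_iso_def)
      also have "\<dots> = x - y"
        using t v(1,2) by (simp add: even_part_def odd_part_def eigensum_singleton)
      finally show "t v = odd_sign_change a v"
        using v by (simp add: odd_sign_change_even_odd)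
    qed
  qed
  then show ?thesis
    using xy by (simp add: odd_sign_change_even_odd)
qed

section \<open>Collapse of the shape\<close>

text \<open>In 4B the vector \<open>a\<^sub>1 - a\<^sub>3\<close> is a \<open>1/32\<close>-eigenvector of \<open>a\<^sub>0\<close>.  Also \<open>a\<^sub>2 - a\<^bsub>\<rho>\<^sup>2\<^esub>\<close> is a
  \<open>1/4\<close>-eigenvector, and correcting \<open>a\<^sub>1 + a\<^sub>3\<close> by multiples of it and of \<open>a\<^sub>0\<close> gives a
  \<open>0\<close>-eigenvector; so \<open>a\<^sub>1 + a\<^sub>3\<close> is even and the Miyamoto involution of \<open>a\<^sub>0\<close> exchanges \<open>a\<^sub>1\<close>
  and \<open>a\<^sub>3\<close>.\<close>

lemma miyamoto_4B:
  assumes p: "monster_axis p" and prods: "axis_products_4B p q r s u"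
  shows "miyamoto p q = s"
proof -
  let ?w = "r - u"
  let ?z = "q + s + (1/8) *s ?w - (1/32) *s p"
  have double: "v + v = 2 *s v" for v
    using scale_left_distrib[of 1 1 v] by simp
  have cancel: "v + x - y - x + y = v" for v x y :: 'v
    by (simp add: algebra_simps)
  have pp: "p \<cdot> p = p"
    using p by (simp add: monster_axis_def)
  have pq: "p \<cdot> q = (1/64) *s (p + q - s - r + u)" and ps: "p \<cdot> s = (1/64) *s (p + s - q - r + u)"
    and pr: "p \<cdot> r = (1/8) *s (p + r - u)" and pu: "p \<cdot> u = (1/8) *s (p + u - r)"
    using prods by (auto simp only: axis_products_4B_def)
  have "p \<cdot> (q - s) = (1/64) *s ((p + q - s - r + u) - (p + s - q - r + u))"
    by (simp only: mult_diff_right pq ps scale_right_diff_distrib[symmetric])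
  also have "(p + q - s - r + u) - (p + s - q - r + u) = (q - s) + (q - s)"
    by (simp add: algebra_simps)
  finally have odd: "p \<cdot> (q - s) = (1/32) *s (q - s)"
    by (simp only: double scale_scale) simp
  have "p \<cdot> ?w = (1/8) *s ((p + r - u) - (p + u - r))"
    by (simp only: mult_diff_right pr pu scale_right_diff_distrib[symmetric])
  also have "(p + r - u) - (p + u - r) = ?w + ?w"
    by (simp add: algebra_simps)
  finally have quarter: "p \<cdot> ?w = (1/4) *s ?w"
    by (simp only: double scale_scale) simp
  have "p \<cdot> (q + s) = (1/64) *s ((p + q - s - r + u) + (p + s - q - r + u))"
    by (simp only: mult_add_right pq ps scale_right_distrib[symmetric])
  also have "(p + q - s - r + u) + (p + s - q - r + u) = (p - ?w) + (p - ?w)"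
    by (simp add: algebra_simps)
  finally have "p \<cdot> (q + s) = (1/32) *s (p - ?w)"
    by (simp only: double scale_scale) simp
  then have sum: "p \<cdot> (q + s) = (1/32) *s p - (1/32) *s ?w"
    by (simp only: scale_right_diff_distrib[of _ p ?w])
  have "p \<cdot> ?z = (1/32) *s p - (1/32) *s ?w + (1/8) *s ((1/4) *s ?w) - (1/32) *s p"
    by (simp only: mult_diff_right[of p "q + s + (1/8) *s ?w"] mult_add_right[of p "q + s"]
        mult_scale_right sum quarter pp)
  also have "\<dots> = 0 *s ?z"
    unfolding scale_scale by simp
  finally have zero: "p \<cdot> ?z = 0 *s ?z" .
  have eigen: "v \<in> even_part p" if "p \<cdot> v = l *s v" "l \<in> {1, 0, 1/4}" for v l
    using eigenspace_subset_eigensum[OF that(2)] that(1) by (auto simp: even_part_def eigenspace_def)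
  have p_even: "p \<in> even_part p"
    by (rule eigen[of _ 1]) (simp_all add: pp)
  have w_even: "?w \<in> even_part p"
    by (rule eigen[OF quarter]) simp
  have z_even: "?z \<in> even_part p"
    by (rule eigen[OF zero]) simp
  note even = subspace_parts(1)[of p]
  have "?z - (1/8) *s ?w + (1/32) *s p \<in> even_part p"
    by (rule subspace_add[OF even subspace_diff[OF even z_even subspace_scale[OF even w_even]]
          subspace_scale[OF even p_even]])
  also have "?z - (1/8) *s ?w + (1/32) *s p = q + s"
    using cancel[of "q + s" "(1/8) *s ?w" "(1/32) *s p"] .
  finally have "(1/2) *s (q + s) \<in> even_part p"
    by (rule subspace_scale[OF even])
  moreover have "q - s \<in> odd_part p"
    using odd by (simp add: odd_part_def eigensum_singleton eigenspace_def)
  then have "(1/2) *s (q - s) \<in> odd_part p"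
    by (rule subspace_scale[OF subspace_parts(2)])
  ultimately have "miyamoto p ((1/2) *s (q + s) + (1/2) *s (q - s)) =
      (1/2) *s (q + s) - (1/2) *s (q - s)"
    by (rule miyamoto_add[OF p])
  moreover have "(1/2) *s (q + s) + (1/2) *s (q - s) = (1/2) *s (q + q)"
    by (simp add: scale_right_distrib[symmetric])
  moreover have "(1/2) *s (q + s) - (1/2) *s (q - s) = (1/2) *s (s + s)"
    by (simp add: scale_right_diff_distrib[symmetric])
  moreover have "(1/2) *s (v + v) = v" for v
    by (simp add: double)
  ultimately show ?thesis
    by simp
qed

end

theorem proposition5p1:
  fixes scale :: "'f::field_char_0 \<Rightarrow> 'v::ab_group_add \<Rightarrow> 'v"
    and mult :: "'v \<Rightarrow> 'v \<Rightarrow> 'v"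
    and a b c d e f :: 'v
  assumes "monster_axial_algebra scale mult {a, b, c, d, e, f}"
    and "distinct [a, b, c, d, e, f]"
    and "\<forall>x\<in>{a, b}. \<forall>y\<in>{a, b, c, d, e, f}.
           commutative_algebra.miyamoto scale mult x y = (transpose c d \<circ> transpose e f) y"
    and "\<forall>x\<in>{c, d, e, f}. \<forall>y\<in>{a, b, c, d, e, f}.
           commutative_algebra.miyamoto scale mult x y = transpose a b y"
    and "commutative_algebra.dihedral_4B scale mult a c"
    and "commutative_algebra.dihedral_4B scale mult a e"
    and "commutative_algebra.dihedral_2B scale mult c e"
    and "commutative_algebra.dihedral_2B scale mult c f"
  shows False
proof -
  interpret monster_axial_algebra scale mult "{a, b, c, d, e, f}"
    by (rule assms(1))
  interpret commutative_algebra_char_0 scale mult ..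
  have axis: "monster_axis a" "monster_axis c" "monster_axis e"
    by (simp_all add: axes)
  have tau: "miyamoto a e = f" "miyamoto c a = b" "miyamoto e a = b"
    using assms(2-4) by (auto simp: transpose_def)
  obtain r s u where ac: "axis_products_4B a c r s u" and ca: "axis_products_4B c a s r u"
    using dihedral_4B_axis_products[OF assms(5)] .
  obtain r' s' u' where ae: "axis_products_4B a e r' s' u'" and ea: "axis_products_4B e a s' r' u'"
    using dihedral_4B_axis_products[OF assms(6)] .
  have "r = b" "r' = b" "s' = f"
    using miyamoto_4B[OF axis(2) ca] miyamoto_4B[OF axis(3) ea] miyamoto_4B[OF axis(1) ae] tau
    by simp_all
  \<comment> \<open>both 4B algebras now express the product of \<open>a\<close> and \<open>b\<close>\<close>
  then have "scale (1/8) (a + b - u) = scale (1/8) (a + b - u')"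
    using ac ae by (simp add: axis_products_4B_def)
  then have "u' = u"
    by simp
  then have ef: "mult e f = scale (1/8) (e + f - u)"
    using ea \<open>s' = f\<close> by (simp add: axis_products_4B_def)
  have "e \<in> eigenspace c 0" "f \<in> eigenspace c 0"
    using dihedral_2B_product_eq_0 assms(7,8) by (simp_all add: eigenspace_def)
  moreover from this have "mult e f \<in> eigenspace c 0"
    by (rule zero_eigenspace_mult_closed[OF axis(2)])
  \<comment> \<open>this vector is \<open>u\<close>\<close>
  ultimately have "e + f - scale 8 (mult e f) \<in> eigenspace c 0"
    by (intro subspace_add subspace_diff subspace_scale subspace_eigenspace)
  then have cu: "mult c u = 0"
    by (simp add: ef eigenspace_def)
  then have "s = c + u"
    using ca by (simp add: axis_products_4B_def)
  have "mult c s = scale (1/8) (c + s - u)"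
    using ca by (simp add: axis_products_4B_def)
  also have "c + s - u = scale 2 c"
    using scale_left_distrib[of 1 1 c] \<open>s = c + u\<close> by simp
  finally have "mult c s = scale (1/4) c"
    by simp
  moreover have "mult c s = c"
    using axis(2) cu by (simp add: \<open>s = c + u\<close> mult_add_right monster_axis_def)
  ultimately have "scale (1/4) c = scale 1 c"
    by simp
  then have "c = 0"
    by (subst (asm) scale_cancel_right) simp
  then show False
    using axis(2) by (simp add: monster_axis_def)
qed

end
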